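(* Let $\Gamma$ be a group acting on a set $X$, with a finite generating set $\mathcal{G}=\{\gamma_1,\dots,\gamma_n\}$. Suppose there exist elements $\sigma,\tau\in\Gamma$, subsets $U_\sigma,U_\tau\subset X$, and a point $x\in X$, such that (1) $x\notin (U_\sigma\cup U_\tau)\cup\bigcup_{\varepsilon=\pm1}\bigcup_{i=1}^n\gamma_i^{\varepsilon}(U_\sigma\cup U_\tau)$; (2) $\sigma^k\Big(\{x\}\cup U_\tau\cup\bigcup_{\varepsilon=\pm1}\bigcup_{i=1}^n\gamma_i^{\varepsilon}(U_\tau)\Big)\subset U_\sigma$ for all $k\in\mathbb{Z}\setminus\{0\}$; and (3) $\tau^k\Big(\{x\}\cup U_\sigma\cup\bigcup_{\varepsilon=\pm1}\bigcup_{i=1}^n\gamma_i^{\varepsilon}(U_\sigma)\Big)\subset U_\tau$ for all $k\in\mathbb{Z}\setminus\{0\}$. Then $\Gamma$ is a non-cyclic group with infinite girth.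
   Context: Girth of a group: for a finitely generated group $\Gamma$ and a finite generating set $\mathcal{G}$, let $U(\Gamma,\mathcal{G})$ be the girth (length of a shortest cycle, $\infty$ if there is no cycle) of the Cayley graph of $\Gamma$ with respect to $\mathcal{G}$. The Cayley graph is taken as a multigraph with one edge from $g$ to $gs$ for each $g\in\Gamma$, $s\in\mathcal{G}$, loops and double edges counting as cycles of length $1$ and $2$; equivalently, $U(\Gamma,\mathcal{G})$ is the least length of a non-empty freely reduced word in the letters $\mathcal{G}$ and their formal inverses that represents the identity of $\Gamma$ ($\infty$ if there is none). The girth of $\Gamma$ is $U(\Gamma)=\sup_{\mathcal{G}}U(\Gamma,\mathcal{G})$, the supremum over all finite generating sets. *)

theory Defs
  imports "HOL-Algebra.Group_Action" "HOL-Algebra.Elementary_Groups" "HOL-Library.Extended_Nat" "Graph_Theory.Digraph"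
begin

text \<open>A \<^typ>\<open>('a, 'b) pre_digraph\<close> is used as an undirected multigraph by ignoring the
  orientation of its arcs. A cycle visits pairwise distinct vertices along pairwise distinct edges,
  each of which may be traversed in either direction. A loop is thus a cycle of length 1, and two
  distinct edges with the same endpoints form a cycle of length 2, whereas going back and forth
  along a single edge is not a cycle.\<close>

definition multigraph_cycle :: "('a, 'b) pre_digraph \<Rightarrow> 'a list \<Rightarrow> 'b list \<Rightarrow> bool" where
  "multigraph_cycle H vs es \<longleftrightarrow>
     es \<noteq> [] \<and> length vs = length es \<and>
     set vs \<subseteq> verts H \<and> set es \<subseteq> arcs H \<and> distinct vs \<and> distinct es \<and>
     (\<forall>i < length es. {tail H (es ! i), head H (es ! i)} = {vs ! i, vs ! (Suc i mod length es)})"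

text \<open>The infimum of the empty set in \<^typ>\<open>enat\<close> is \<open>\<infinity>\<close>, the girth of a graph without cycles.\<close>

definition multigraph_girth :: "('a, 'b) pre_digraph \<Rightarrow> enat" where
  "multigraph_girth H = Inf {enat (length es) | vs es. multigraph_cycle H vs es}"

text \<open>Edges are pairs \<open>(g, s)\<close>, so that an involution in \<open>S\<close>, or two mutually inverse elements
  of \<open>S\<close>, give rise to double edges.\<close>

definition cayley_graph :: "('g, 'm) monoid_scheme \<Rightarrow> 'g set \<Rightarrow> ('g, 'g \<times> 'g) pre_digraph" where
  "cayley_graph G S =
     \<lparr>verts = carrier G, arcs = carrier G \<times> S, tail = fst, head = (\<lambda>(g, s). g \<otimes>\<^bsub>G\<^esub> s)\<rparr>"

definition finite_generating_set :: "('g, 'm) monoid_scheme \<Rightarrow> 'g set \<Rightarrow> bool" where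
  "finite_generating_set G S \<longleftrightarrow> finite S \<and> S \<subseteq> carrier G \<and> generate G S = carrier G"

definition group_girth :: "('g, 'm) monoid_scheme \<Rightarrow> enat" where
  "group_girth G = Sup {multigraph_girth (cayley_graph G S) | S. finite_generating_set G S}"

end

theory Submission
  imports Defs
begin

text \<open>
  Ping-pong. Replace the given generators by \<open>\<sigma>\<close>, \<open>\<tau>\<close> and the elements
  \<open>\<sigma>\<^bsup>Mi\<^esup> \<gamma>\<^sub>i \<tau>\<^bsup>-Mi\<^esup>\<close>. In a non-empty reduced word of length less than \<open>M\<close> in these, gathering
  neighbouring powers of \<open>\<sigma>\<close> and of \<open>\<tau>\<close> never produces the exponent \<open>0\<close>, because the multiples
  \<open>Mi\<close> are at least \<open>M\<close> apart; and each \<open>\<gamma>\<^sub>i\<^sup>\<plusminus>\<close> is surrounded by a power of \<open>\<sigma>\<close> and a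
  power of \<open>\<tau>\<close>. Hence such a word moves \<open>x\<close> into \<open>U\<^sub>\<sigma> \<union> U\<^sub>\<tau>\<close> and is not trivial in the
  group, so the new Cayley graph has girth at least \<open>M\<close>. In the same way the commutator of \<open>\<sigma>\<close>
  and \<open>\<tau>\<close> moves \<open>x\<close> into \<open>U\<^sub>\<sigma>\<close>, so the group is not abelian.
\<close>

section \<open>Words read off from cycles in Cayley graphs\<close>

definition word_value :: "('g, 'm) monoid_scheme \<Rightarrow> ('l \<Rightarrow> 'g) \<Rightarrow> 'l list \<Rightarrow> 'g" where
  "word_value G f ws = foldr (\<lambda>l g. f l \<otimes>\<^bsub>G\<^esub> g) ws \<one>\<^bsub>G\<^esub>"

lemma word_value_simps [simp]:
  "word_value G f [] = \<one>\<^bsub>G\<^esub>"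
  "word_value G f (l # ws) = f l \<otimes>\<^bsub>G\<^esub> word_value G f ws"
  by (simp_all add: word_value_def)

lemma word_value_map: "word_value G f (map h ws) = word_value G (f \<circ> h) ws"
  by (simp add: word_value_def foldr_map comp_def)

lemma word_value_cong:
  "(\<And>l. l \<in> set ws \<Longrightarrow> f l = f' l) \<Longrightarrow> word_value G f ws = word_value G f' ws"
  by (induction ws) auto

lemma (in group) word_value_closed:
  "(\<And>l. l \<in> set ws \<Longrightarrow> f l \<in> carrier G) \<Longrightarrow> word_value G f ws \<in> carrier G"
  by (induction ws) auto

definition signed_value :: "('g, 'm) monoid_scheme \<Rightarrow> 'g \<times> bool \<Rightarrow> 'g" where
  "signed_value G = (\<lambda>(s, e). if e then s else inv\<^bsub>G\<^esub> s)"

text \<open>The edge labels around the cycle, signed by the direction of traversal, multiply to an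
  element fixing the first vertex under right multiplication. A cancelling pair of neighbours would
  be one edge used twice.\<close>

lemma (in group) cayley_cycle_imp_word:
  assumes S: "S \<subseteq> carrier G" and cyc: "multigraph_cycle (cayley_graph G S) vs es"
  obtains ws where "length ws = length es" "set ws \<subseteq> S \<times> UNIV"
    "successively (\<lambda>(s, e) (s', e'). s = s' \<longrightarrow> e = e') ws"
    "word_value G (signed_value G) ws = \<one>"
proof -
  define m where "m = length es"
  \<comment> \<open>Reducing the index modulo \<open>m\<close> makes \<open>v m = v 0\<close>, which
    closes the walk.\<close>
  define v where "v i = vs ! (i mod m)" for i
  define w where
    "w i = (snd (es ! i), fst (es ! i) = v i \<and> v i \<otimes> snd (es ! i) = v (Suc i))" for i
  have m: "m > 0" and lv: "length vs = m" and vs: "set vs \<subseteq> carrier G"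
    and es: "set es \<subseteq> carrier G \<times> S" and dist: "distinct es"
    and ends: "\<And>i. i < m \<Longrightarrow>
      {fst (es ! i), fst (es ! i) \<otimes> snd (es ! i)} = {vs ! i, vs ! (Suc i mod m)}"
    using cyc by (auto simp: multigraph_cycle_def cayley_graph_def m_def case_prod_unfold)
  have v: "v i \<in> carrier G" for i
    using vs m lv by (auto simp: v_def)
  have sS: "snd (es ! i) \<in> S" if "i < m" for i
  proof -
    have "es ! i \<in> set es" using that by (simp add: m_def)
    then show ?thesis using es by (metis mem_Times_iff subsetD)
  qed
  have s: "snd (es ! i) \<in> carrier G" if "i < m" for i
    using sS[OF that] S by auto
  have neg: "fst (es ! i) = v (Suc i) \<and> v (Suc i) \<otimes> snd (es ! i) = v i"
    if "i < m" "\<not> snd (w i)" for i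
    using ends[of i] that by (auto simp: w_def v_def doubleton_eq_iff)
  have w: "signed_value G (w i) \<in> carrier G" if "i < m" for i
    using s[OF that] by (simp add: signed_value_def w_def)
  have edge: "v i \<otimes> signed_value G (w i) = v (Suc i)" if "i < m" for i
  proof (cases "snd (w i)")
    case True
    then show ?thesis by (simp add: w_def signed_value_def)
  next
    case False
    have "v i \<otimes> inv (snd (es ! i)) = v (Suc i)"
      using neg[OF that False] v s[OF that] by (simp add: inv_solve_right')
    then show ?thesis using False by (simp add: w_def signed_value_def)
  qed
  have tail: "v i \<otimes> word_value G (signed_value G) (map w [i..<m]) = v m" if "i \<le> m" for i
    using that
  proof (induction rule: inc_induct)
    case base
    then show ?case using v by simp
  next
    case (step i)
    have "word_value G (signed_value G) (map w [Suc i..<m]) \<in> carrier G"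
      by (rule word_value_closed) (use w in auto)
    then show ?case
      using step w[of i] v edge[of i] by (simp add: upt_conv_Cons flip: m_assoc)
  qed
  have W: "word_value G (signed_value G) (map w [0..<m]) \<in> carrier G"
    by (rule word_value_closed) (use w in auto)
  have "v 0 \<otimes> word_value G (signed_value G) (map w [0..<m]) = v 0"
    using tail[of 0] by (simp add: v_def)
  then have one: "word_value G (signed_value G) (map w [0..<m]) = \<one>"
    using v W by simp
  have red: "snd (w i) = snd (w (Suc i))" if i: "Suc i < m" and eq: "fst (w i) = fst (w (Suc i))" for i
  proof (rule ccontr)
    assume ne: "snd (w i) \<noteq> snd (w (Suc i))"
    \<comment> \<open>An edge is determined by its tail and its label, so equal tails suffice.
      Forward then backward: cancelling the common label gives \<open>v (Suc (Suc i)) = v i\<close>.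
      Backward then forward: both tails are \<open>v (Suc i)\<close>.\<close>
    have "fst (es ! i) = fst (es ! Suc i)"
    proof (cases "snd (w i)")
      case True
      then have "\<not> snd (w (Suc i))" using ne by simp
      from neg[OF i this] True eq have "v (Suc (Suc i)) \<otimes> snd (es ! i) = v i \<otimes> snd (es ! i)"
        by (simp add: w_def)
      then have "v (Suc (Suc i)) = v i"
        using v s[of i] i by simp
      then show ?thesis using neg[OF i \<open>\<not> snd (w (Suc i))\<close>] True by (simp add: w_def)
    next
      case False
      then have "snd (w (Suc i))" using ne by simp
      then have "fst (es ! Suc i) = v (Suc i)" by (simp add: w_def)
      moreover have "fst (es ! i) = v (Suc i)" using neg[of i] i False by simp
      ultimately show ?thesis by simp
    qed
    with eq have "es ! i = es ! Suc i" by (simp add: w_def prod_eq_iff)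
    then show False using dist i by (simp add: m_def nth_eq_iff_index_eq)
  qed
  have "successively (\<lambda>(s, e) (s', e'). s = s' \<longrightarrow> e = e') (map w [0..<m])"
    using red by (auto simp: successively_conv_nth case_prod_unfold)
  moreover have "set (map w [0..<m]) \<subseteq> S \<times> UNIV"
    using sS by (auto simp: w_def)
  ultimately show thesis
    using one that[of "map w [0..<m]"] by (simp add: m_def)
qed

section \<open>Letters for the new generators and the ping-pong setting\<close>

text \<open>The boolean stands for \<open>\<sigma>\<close> (\<open>True\<close>) or \<open>\<tau>\<close> (\<open>False\<close>) in the first argument of both
  constructors; in the second argument of \<open>Pow\<close> it is the sign of the exponent. Exchanging \<open>\<sigma>\<close>
  with \<open>\<tau>\<close> and \<open>\<gamma>\<^sub>i\<close> with its inverse turns \<open>\<sigma>\<^bsup>Mi\<^esup> \<gamma>\<^sub>i \<tau>\<^bsup>-Mi\<^esup>\<close> into its own inverse.\<close>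

datatype letter = Pow bool bool | Conj bool nat

fun letter_inv :: "letter \<Rightarrow> letter" where
  "letter_inv (Pow b e) = Pow b (\<not> e)"
| "letter_inv (Conj b i) = Conj (\<not> b) i"

fun letter_value ::
  "('g, 'm) monoid_scheme \<Rightarrow> (bool \<Rightarrow> 'g) \<Rightarrow> (bool \<Rightarrow> nat \<Rightarrow> 'g) \<Rightarrow> int \<Rightarrow> letter \<Rightarrow> 'g" where
  "letter_value G s c M (Pow b e) = s b [^]\<^bsub>G\<^esub> (if e then 1 else - 1 :: int)"
| "letter_value G s c M (Conj b i) =
     s b [^]\<^bsub>G\<^esub> (M * int i) \<otimes>\<^bsub>G\<^esub> (c b i \<otimes>\<^bsub>G\<^esub> s (\<not> b) [^]\<^bsub>G\<^esub> (- (M * int i)))"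

fun valid_letter :: "nat \<Rightarrow> letter \<Rightarrow> bool" where
  "valid_letter n (Pow b e) = True"
| "valid_letter n (Conj b i) = (i \<in> {1..n})"

lemma valid_letter_inv [simp]: "valid_letter n (letter_inv l) = valid_letter n l"
  by (cases l) auto

lemma letter_inv_inv [simp]: "letter_inv (letter_inv l) = l"
  by (cases l) auto

lemma letter_inv_eq_iff [simp]: "letter_inv l = letter_inv l' \<longleftrightarrow> l = l'"
  by (metis letter_inv_inv)

text \<open>Otherwise \<open>M\<close> divides \<open>t\<close>, so \<open>t = 0\<close> by size and
  then \<open>i = 0\<close>. It serves for gathered exponents, with \<open>i\<close> an index or a
  difference of two indices.\<close>

lemma multiple_plus_ne_0:
  fixes M t :: int
  assumes "\<bar>t\<bar> < M" "t \<noteq> 0 \<or> i \<noteq> 0"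
  shows "M * i + t \<noteq> 0"
proof
  assume "M * i + t = 0"
  then have "M dvd t" by (metis add.commute dvd_add_times_triv_right_iff dvd_0_right mult.commute)
  then have "t = 0" using assms(1) zdvd_not_zless[of "\<bar>t\<bar>" M] by fastforce
  with \<open>M * i + t = 0\<close> assms show False by auto
qed

text \<open>Indexing by booleans makes \<sigma> and \<tau> interchangeable, so each argument is
  given once. Here \<open>c True i\<close> stands for the generator \<gamma> with index
  \<open>i\<close> and \<open>c False i\<close> for its inverse.\<close>

locale ping_pong = group_action G X \<phi> for G (structure) and X and \<phi> :: "'g \<Rightarrow> 'x \<Rightarrow> 'x" +
  fixes s :: "bool \<Rightarrow> 'g" and c :: "bool \<Rightarrow> nat \<Rightarrow> 'g" and n :: nat
    and U :: "bool \<Rightarrow> 'x set" and x :: 'x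
  assumes s_closed [simp]: "s b \<in> carrier G"
    and c_closed [simp]: "i \<in> {1..n} \<Longrightarrow> c b i \<in> carrier G"
    and c_inv: "i \<in> {1..n} \<Longrightarrow> c (\<not> b) i = inv (c b i)"
    and U_subset: "U b \<subseteq> X"
    and x_in: "x \<in> X"
    and x_notin: "x \<notin> U b"
    and pow_x: "k \<noteq> 0 \<Longrightarrow> \<phi> (s b [^] (k::int)) x \<in> U b"
    and pow_U: "k \<noteq> 0 \<Longrightarrow> z \<in> U (\<not> b) \<Longrightarrow> \<phi> (s b [^] (k::int)) z \<in> U b"
    and pow_c_U: "k \<noteq> 0 \<Longrightarrow> i \<in> {1..n} \<Longrightarrow> z \<in> U (\<not> b) \<Longrightarrow>
      \<phi> (s b [^] (k::int)) (\<phi> (c b i) z) \<in> U b"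

sublocale ping_pong \<subseteq> group G
  using group_hom group_hom.axioms(1) by auto

section \<open>The ping-pong action on reduced words\<close>

context ping_pong
begin

text \<open>The points to which a power of \<open>s b\<close> gets applied: the start, a point left
  by the other player, or such a point moved by the middle factor of
  \<open>Conj b i\<close>.\<close>

definition source :: "bool \<Rightarrow> 'x set" where
  "source b = {x} \<union> U (\<not> b) \<union> (\<Union>i\<in>{1..n}. \<phi> (c b i) ` U (\<not> b))"

lemma source_subset: "source b \<subseteq> X"
  using x_in U_subset[of "\<not> b"] element_image[OF c_closed] by (fastforce simp: source_def)

lemma pow_source: "k \<noteq> 0 \<Longrightarrow> z \<in> source b \<Longrightarrow> \<phi> (s b [^] (k::int)) z \<in> U b"
  using pow_x pow_U pow_c_U by (auto simp: source_def)

lemma pow_pow: "z \<in> X \<Longrightarrow> \<phi> (s b [^] (k::int)) (\<phi> (s b [^] (l::int)) z) = \<phi> (s b [^] (k + l)) z"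
  by (simp add: composition_rule int_pow_mult)

lemma letter_value_closed [simp]: "valid_letter n l \<Longrightarrow> letter_value G s c M l \<in> carrier G"
  by (cases l) auto

lemma letter_value_inv:
  "valid_letter n l \<Longrightarrow> letter_value G s c M (letter_inv l) = inv (letter_value G s c M l)"
proof (cases l)
  case (Pow b e)
  then show ?thesis by (simp add: int_pow_neg)
next
  case (Conj b i)
  assume "valid_letter n l"
  then have i: "i \<in> {1..n}" using Conj by simp
  then show ?thesis using Conj c_closed[OF i]
    by (simp add: inv_mult_group int_pow_neg c_inv m_assoc)
qed

text \<open>The hypothesis \<open>U\<close> is to be checked after the rightmost power of the letter
  has merged with a power of \<open>s (\<not> b)\<close> possibly already contained in
  \<open>y\<close>.\<close>

lemma conj_action:
  assumes i: "i \<in> {1..n}" and y: "y \<in> X" and U: "\<phi> (s (\<not> b) [^] (- (M * int i))) y \<in> U (\<not> b)"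
  obtains z where "z \<in> source b"
    "\<phi> (letter_value G s c M (Conj b i)) y = \<phi> (s b [^] (M * int i)) z"
proof
  show "\<phi> (c b i) (\<phi> (s (\<not> b) [^] (- (M * int i))) y) \<in> source b"
    using i U by (auto simp: source_def)
  show "\<phi> (letter_value G s c M (Conj b i)) y =
      \<phi> (s b [^] (M * int i)) (\<phi> (c b i) (\<phi> (s (\<not> b) [^] (- (M * int i))) y))"
    using i y by (simp add: composition_rule element_image)
qed

text \<open>The invariant of the ping-pong: the image of \<open>x\<close> has the form \<open>s\<^sub>b\<^bsup>Mi + t\<^esup> z\<close>, where \<open>t\<close> counts the
  letters \<open>s\<^sub>b\<^sup>\<plusminus>\<close> read since the last change and \<open>Mi\<close> comes from a preceding letter \<open>Conj b i\<close>
  (\<open>i = 0\<close> if there is none).\<close>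

lemma word_action:
  assumes "ws \<noteq> []" "int (length ws) < M" "\<And>l. l \<in> set ws \<Longrightarrow> valid_letter n l"
    and "successively (\<lambda>l l'. l \<noteq> letter_inv l') ws"
  shows "\<exists>b i t z. z \<in> source b
    \<and> \<phi> (word_value G (letter_value G s c M) ws) x = \<phi> (s b [^] (M * int i + t)) z
    \<and> \<bar>t\<bar> \<le> int (length ws) \<and> hd ws = (if t = 0 then Conj b i else Pow b (t > 0))"
  using assms
proof (induction ws)
  case (Cons l ws)
  let ?val = "letter_value G s c M"
  define y where "y = \<phi> (word_value G ?val ws) x"
  have M: "M > 0" using Cons.prems by simp
  have l: "valid_letter n l" using Cons.prems by simp
  have val: "word_value G ?val ws \<in> carrier G"
    by (rule word_value_closed) (use Cons.prems in auto)
  have y: "y \<in> X" using element_image[OF val x_in] by (simp add: y_def)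
  have ly: "\<phi> (word_value G ?val (l # ws)) x = \<phi> (?val l) y"
    using l val x_in by (simp add: composition_rule y_def)
  let ?goal = "\<exists>b i t z. z \<in> source b \<and> \<phi> (?val l) y = \<phi> (s b [^] (M * int i + t)) z
    \<and> \<bar>t\<bar> \<le> int (Suc (length ws)) \<and> l = (if t = 0 then Conj b i else Pow b (t > 0))"
  \<comment> \<open>A fresh block of powers: \<open>i = 0\<close>, which is no valid index, and
    \<open>t\<close> is the sign of the letter.\<close>
  have new_pow: ?goal if "l = Pow b e" "y \<in> source b" for b e
    using that by (intro exI[of _ b] exI[of _ 0] exI[of _ "if e then 1 else -1"] exI[of _ y]) auto
  have new_conj: ?goal if "l = Conj b i" "\<phi> (s (\<not> b) [^] (- (M * int i))) y \<in> U (\<not> b)" for b i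
  proof -
    have "i \<in> {1..n}" using l that by simp
    from conj_action[OF this y that(2)] obtain z where
      "z \<in> source b" "\<phi> (?val (Conj b i)) y = \<phi> (s b [^] (M * int i)) z" .
    then show ?thesis
      using that by (intro exI[of _ b] exI[of _ i] exI[of _ 0] exI[of _ z]) auto
  qed
  have new_conj_source: ?goal if "l = Conj b i" "y \<in> source (\<not> b)" for b i
    using that l M by (intro new_conj pow_source) auto
  have ?goal
  proof (cases "ws = []")
    case True
    then have "y = x" using orbit_sym_aux x_in by (simp add: y_def flip: id_eq_one)
    then have "y \<in> source b" for b by (simp add: source_def)
    then show ?thesis using new_pow new_conj_source by (cases l) auto
  next
    case False
    have "\<exists>b i t z. z \<in> source b \<and> y = \<phi> (s b [^] (M * int i + t)) z
      \<and> \<bar>t\<bar> \<le> int (length ws) \<and> hd ws = (if t = 0 then Conj b i else Pow b (t > 0))"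
      unfolding y_def using Cons.prems False by (intro Cons.IH) (auto simp: successively_Cons)
    then obtain b i t z where z: "z \<in> source b" and yz: "y = \<phi> (s b [^] (M * int i + t)) z"
      and t: "\<bar>t\<bar> \<le> int (length ws)" and hd: "hd ws = (if t = 0 then Conj b i else Pow b (t > 0))"
      by blast
    have zX: "z \<in> X" using z source_subset by auto
    have tM: "\<bar>t\<bar> < M" using t Cons.prems by simp
    have "valid_letter n (hd ws)" using Cons.prems False by simp
    then have i: "i \<in> {1..n}" if "t = 0" using hd that by simp
    have red: "l \<noteq> letter_inv (hd ws)" using Cons.prems False by (simp add: successively_Cons)
    \<comment> \<open>If \<open>t = 0\<close>, the head is a valid \<open>Conj b i\<close>, so
      \<open>i\<close> is at least 1.\<close>
    have "M * int i + t \<noteq> 0" using tM i by (intro multiple_plus_ne_0) auto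
    then have "y \<in> U b" using pow_source z yz by simp
    then have src: "y \<in> source (\<not> b)" by (simp add: source_def)
    show ?thesis
    proof (cases l)
      case (Pow b' e)
      show ?thesis
      proof (cases "b' = b")
        case True
        \<comment> \<open>Reducedness forces the sign of the running count, so \<open>t\<close>
          moves away from 0 and still describes the head letter.\<close>
        have e: "e \<longleftrightarrow> t > 0" if "t \<noteq> 0" using red hd that Pow True by auto
        have "\<phi> (?val l) y = \<phi> (s b [^] ((if e then 1 else - 1) + (M * int i + t))) z"
          unfolding yz Pow letter_value.simps True by (rule pow_pow[OF zX])
        then show ?thesis
          using Pow True z t e
          by (intro exI[of _ b] exI[of _ i] exI[of _ "t + (if e then 1 else - 1)"] exI[of _ z])
             (cases "t = 0"; auto simp: algebra_simps)
      next
        case False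
        then have "b' = (\<not> b)" by auto
        with src show ?thesis by (intro new_pow[OF Pow]) simp
      qed
    next
      case (Conj b' j)
      show ?thesis
      proof (cases "b' = b")
        case True
        then show ?thesis using new_conj_source[OF Conj] src by simp
      next
        case False
        then have b': "b' = (\<not> b)" by auto
        \<comment> \<open>The letter ends in a power of the same \<open>s b\<close>, and the
          exponents merge to \<open>M * (i - j) + t\<close>. If \<open>t = 0\<close>, the head is
          \<open>Conj b i\<close>, and \<open>i = j\<close> would make the new letter its
          inverse.\<close>
        have "t \<noteq> 0 \<or> i \<noteq> j" using red hd Conj b' by auto
        then have "M * (int i - int j) + t \<noteq> 0" using tM by (intro multiple_plus_ne_0) auto
        then have "- (M * int j) + (M * int i + t) \<noteq> 0" by (simp add: algebra_simps)
        then have "\<phi> (s b [^] (- (M * int j) + (M * int i + t))) z \<in> U b"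
          by (rule pow_source[OF _ z])
        then have "\<phi> (s b [^] (- (M * int j))) y \<in> U b"
          unfolding yz pow_pow[OF zX] .
        then show ?thesis using new_conj[OF Conj] b' by simp
      qed
    qed
  qed
  then show ?case using ly by simp
qed simp

lemma word_value_ne_one:
  assumes "ws \<noteq> []" "int (length ws) < M" "\<And>l. l \<in> set ws \<Longrightarrow> valid_letter n l"
    and "successively (\<lambda>l l'. l \<noteq> letter_inv l') ws"
  shows "word_value G (letter_value G s c M) ws \<noteq> \<one>"
proof
  assume one: "word_value G (letter_value G s c M) ws = \<one>"
  obtain b i t z where z: "z \<in> source b"
    and img: "\<phi> (word_value G (letter_value G s c M) ws) x = \<phi> (s b [^] (M * int i + t)) z"
    and t: "\<bar>t\<bar> \<le> int (length ws)" and hd: "hd ws = (if t = 0 then Conj b i else Pow b (t > 0))"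
    using word_action[OF assms] by blast
  have "valid_letter n (hd ws)" using assms by simp
  then have "t \<noteq> 0 \<or> int i \<noteq> 0" using hd by (auto split: if_splits)
  then have "M * int i + t \<noteq> 0" using t assms(2) by (intro multiple_plus_ne_0) auto
  then have "\<phi> \<one> x \<in> U b" using pow_source z img one by simp
  then show False using x_notin x_in by (simp flip: id_eq_one)
qed

section \<open>Non-commutativity and generating sets of large girth\<close>

lemma not_comm_group: "\<not> comm_group G"
proof
  assume "comm_group G"
  then interpret comm_group G .
  let ?\<sigma> = "s True" and ?\<tau> = "s False"
  have "\<phi> (?\<sigma> [^] (1::int)) (\<phi> (?\<tau> [^] (1::int)) (\<phi> (?\<sigma> [^] (-1::int)) (\<phi> (?\<tau> [^] (-1::int)) x))) \<in> U True"
    by (rule pow_U, simp, simp only: not_True_eq_False, rule pow_U, simp,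
        simp only: not_False_eq_True, rule pow_U, simp, simp only: not_True_eq_False, rule pow_x, simp)
  also have "\<phi> (?\<sigma> [^] (1::int)) (\<phi> (?\<tau> [^] (1::int)) (\<phi> (?\<sigma> [^] (-1::int)) (\<phi> (?\<tau> [^] (-1::int)) x)))
      = \<phi> (?\<sigma> \<otimes> (?\<tau> \<otimes> (inv ?\<sigma> \<otimes> inv ?\<tau>))) x"
    using x_in by (simp add: composition_rule element_image int_pow_neg)
  also have "?\<sigma> \<otimes> (?\<tau> \<otimes> (inv ?\<sigma> \<otimes> inv ?\<tau>)) = \<one>"
    by (metis inv_closed inv_mult m_assoc m_closed r_inv s_closed)
  finally show False using x_notin x_in by (simp flip: id_eq_one)
qed

text \<open>\<open>Conj False i\<close> denotes the inverse of \<open>Conj True i\<close>, so only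
  the latter is listed. Including \<sigma> and \<tau> allows the powers around each
  \<open>c True i\<close> to be stripped off again.\<close>

definition long_generators :: "int \<Rightarrow> 'g set" where
  "long_generators M = {s True, s False} \<union> (\<lambda>i. letter_value G s c M (Conj True i)) ` {1..n}"

lemma long_generators_subset: "long_generators M \<subseteq> carrier G"
  by (auto simp: long_generators_def simp del: letter_value.simps)

lemma generate_long_generators:
  assumes "generate G (c True ` {1..n}) = carrier G"
  shows "generate G (long_generators M) = carrier G"
proof
  let ?H = "generate G (long_generators M)"
  show "?H \<subseteq> carrier G" using generate_incl long_generators_subset by blast
  interpret H: subgroup ?H G
    using generate_is_subgroup long_generators_subset by blast
  have incl: "g \<in> ?H" if "g \<in> long_generators M" for g using that by (rule generate.incl)
  have pow: "s b [^] (k::int) \<in> ?H" for b k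
    by (rule subgroup_int_pow_closed[OF H.subgroup_axioms], rule incl)
       (cases b; simp add: long_generators_def)
  have "c True i \<in> ?H" if i: "i \<in> {1..n}" for i
  proof -
    let ?a = "letter_value G s c M (Conj True i)" and ?p = "s True [^] (M * int i)"
      and ?q = "s False [^] (M * int i)"
    have "?a \<in> ?H" using i by (intro incl) (auto simp: long_generators_def)
    then have "inv ?p \<otimes> (?a \<otimes> ?q) \<in> ?H" using pow by simp
    also have "inv ?p \<otimes> (?a \<otimes> ?q) = c True i"
      using c_closed[OF i] by (simp add: int_pow_neg m_assoc inv_solve_left')
    finally show ?thesis .
  qed
  then have "generate G (c True ` {1..n}) \<subseteq> ?H"
    using generate_subgroup_incl[OF _ H.subgroup_axioms] by blast
  then show "carrier G \<subseteq> ?H" using assms by simp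
qed

lemma girth_long_generators: "enat N \<le> multigraph_girth (cayley_graph G (long_generators (int N)))"
  unfolding multigraph_girth_def
proof (rule Inf_greatest, clarify)
  let ?S = "long_generators (int N)" and ?val = "letter_value G s c (int N)"
  \<comment> \<open>The positive letters: the inverse of one of them is never another one.\<close>
  let ?pos = "insert (Pow True True) (insert (Pow False True) (Conj True ` {1..n}))"
  fix vs es assume "multigraph_cycle (cayley_graph G ?S) vs es"
  moreover from this have "es \<noteq> []" by (simp add: multigraph_cycle_def)
  ultimately obtain ws where len: "length ws = length es" and ne: "ws \<noteq> []"
    and set: "set ws \<subseteq> ?S \<times> UNIV"
    and red: "successively (\<lambda>(g, e) (g', e'). g = g' \<longrightarrow> e = e') ws"
    and one: "word_value G (signed_value G) ws = \<one>"
    by (metis cayley_cycle_imp_word[OF long_generators_subset] length_0_conv)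
  have "\<forall>g\<in>?S. \<exists>l\<in>?pos. ?val l = g" by (auto simp: long_generators_def)
  \<comment> \<open>Cayley graph labels are group elements, and several letters may have the same
    value. Choosing one letter per element makes \<open>rep\<close> injective, since
    \<open>?val\<close> undoes it; hence reduced words go to reduced words.\<close>
  then obtain rep where rep: "\<And>g. g \<in> ?S \<Longrightarrow> rep g \<in> ?pos \<and> ?val (rep g) = g" by metis
  define h where "h = (\<lambda>(g, e). if e then rep g else letter_inv (rep g))"
  have valid: "valid_letter n (rep g)" if "g \<in> ?S" for g using rep[OF that] by auto
  have hvalid: "valid_letter n (h p)" if "p \<in> set ws" for p
    using that set valid by (auto simp: h_def)
  have hval: "?val (h p) = signed_value G p" if "p \<in> set ws" for p
    using that set valid rep by (auto simp: h_def signed_value_def letter_value_inv)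
  have hred: "h (g, e) \<noteq> letter_inv (h (g', e'))"
    if "g \<in> ?S" "g' \<in> ?S" "g = g' \<longrightarrow> e = e'" for g g' e e'
  proof
    assume eq: "h (g, e) = letter_inv (h (g', e'))"
    have pos: "rep g \<noteq> letter_inv (rep g')" "letter_inv (rep g) \<noteq> rep g'"
      using rep[OF that(1)] rep[OF that(2)] by auto
    have "e \<noteq> e' \<and> rep g = rep g'"
      using eq pos by (simp add: h_def split: if_splits)
    then have "g = g'" using rep that by metis
    then show False using that \<open>e \<noteq> e' \<and> rep g = rep g'\<close> by simp
  qed
  have "successively (\<lambda>p q. h p \<noteq> letter_inv (h q)) ws"
  proof (rule successively_mono[OF red])
    fix p q assume "p \<in> set ws" "q \<in> set ws" and
      pq: "(\<lambda>(g, e) (g', e'). g = g' \<longrightarrow> e = e') p q"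
    then have "fst p \<in> ?S" "fst q \<in> ?S" using set by auto
    then show "h p \<noteq> letter_inv (h q)"
      using hred[of "fst p" "fst q" "snd p" "snd q"] pq by (simp add: case_prod_unfold)
  qed
  then have red': "successively (\<lambda>l l'. l \<noteq> letter_inv l') (map h ws)"
    by (simp add: successively_map)
  have "word_value G ?val (map h ws) = word_value G (signed_value G) ws"
    unfolding word_value_map using hval by (intro word_value_cong) simp
  then have "word_value G ?val (map h ws) = \<one>" using one by simp
  moreover have "word_value G ?val (map h ws) \<noteq> \<one>" if "int (length (map h ws)) < int N"
    by (rule word_value_ne_one[OF _ that _ red']) (use ne hvalid in auto)
  ultimately have "\<not> int (length (map h ws)) < int N" by blast
  then show "enat N \<le> enat (length es)" using len by simp
qed

lemma infinite_girth:
  assumes "generate G (c True ` {1..n}) = carrier G"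
  shows "group_girth G = \<infinity>"
proof -
  have fgs: "finite_generating_set G (long_generators (int N))" for N
    using generate_long_generators[OF assms] long_generators_subset
    by (auto simp: finite_generating_set_def long_generators_def)
  have "enat N \<le> group_girth G" for N
    unfolding group_girth_def
    by (rule order_trans[OF girth_long_generators Sup_upper]) (use fgs in blast)
  then show ?thesis by (metis enat_iless not_le enat_ord_simps(2) lessI less_le_trans not_infinity_eq)
qed

end

section \<open>Passage from the two given subsets to the boolean-indexed setting\<close>

theorem proposition10:
  fixes \<Gamma> :: "('g, 'm) monoid_scheme"
    and X :: "'x set"
    and \<phi> :: "'g \<Rightarrow> 'x \<Rightarrow> 'x"
    and \<gamma> :: "nat \<Rightarrow> 'g"
    and n :: nat
    and \<sigma> \<tau> :: 'g
    and U\<^sub>\<sigma> U\<^sub>\<tau> :: "'x set"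
    and x :: 'x
  assumes action: "group_action \<Gamma> X \<phi>"
    and gen: "finite_generating_set \<Gamma> (\<gamma> ` {1..n})"
    and elems: "\<sigma> \<in> carrier \<Gamma>" "\<tau> \<in> carrier \<Gamma>"
    and subsets: "U\<^sub>\<sigma> \<subseteq> X" "U\<^sub>\<tau> \<subseteq> X"
    and point: "x \<in> X"
    and h1: "x \<notin> (U\<^sub>\<sigma> \<union> U\<^sub>\<tau>) \<union>
          (\<Union>\<epsilon>\<in>{1, -1::int}. \<Union>i\<in>{1..n}. \<phi> (\<gamma> i [^]\<^bsub>\<Gamma>\<^esub> \<epsilon>) ` (U\<^sub>\<sigma> \<union> U\<^sub>\<tau>))"
    and h2: "\<And>k::int. k \<noteq> 0 \<Longrightarrow>
          \<phi> (\<sigma> [^]\<^bsub>\<Gamma>\<^esub> k) ` ({x} \<union> U\<^sub>\<tau> \<union>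
            (\<Union>\<epsilon>\<in>{1, -1::int}. \<Union>i\<in>{1..n}. \<phi> (\<gamma> i [^]\<^bsub>\<Gamma>\<^esub> \<epsilon>) ` U\<^sub>\<tau>)) \<subseteq> U\<^sub>\<sigma>"
    and h3: "\<And>k::int. k \<noteq> 0 \<Longrightarrow>
          \<phi> (\<tau> [^]\<^bsub>\<Gamma>\<^esub> k) ` ({x} \<union> U\<^sub>\<sigma> \<union>
            (\<Union>\<epsilon>\<in>{1, -1::int}. \<Union>i\<in>{1..n}. \<phi> (\<gamma> i [^]\<^bsub>\<Gamma>\<^esub> \<epsilon>) ` U\<^sub>\<sigma>)) \<subseteq> U\<^sub>\<tau>"
  shows "\<not> cyclic_group \<Gamma> \<and> group_girth \<Gamma> = \<infinity>"
proof -
  interpret group_action \<Gamma> X \<phi> by (rule action)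
  interpret group \<Gamma> using group_hom group_hom.axioms(1) by auto
  define s where "s b = (if b then \<sigma> else \<tau>)" for b
  define U where "U b = (if b then U\<^sub>\<sigma> else U\<^sub>\<tau>)" for b
  define c where "c b i = \<gamma> i [^]\<^bsub>\<Gamma>\<^esub> (if b then 1 else - 1 :: int)" for b i
  have \<gamma>: "\<gamma> i \<in> carrier \<Gamma>" if "i \<in> {1..n}" for i
    using gen that by (auto simp: finite_generating_set_def)
  have h: "\<phi> (s b [^]\<^bsub>\<Gamma>\<^esub> k) ` ({x} \<union> U (\<not> b) \<union>
      (\<Union>\<epsilon>\<in>{1, -1::int}. \<Union>i\<in>{1..n}. \<phi> (\<gamma> i [^]\<^bsub>\<Gamma>\<^esub> \<epsilon>) ` U (\<not> b))) \<subseteq> U b"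
    if "k \<noteq> 0" for b and k :: int
    using h2[OF that] h3[OF that] by (cases b) (simp_all only: s_def U_def if_True if_False not_True_eq_False not_False_eq_True)
  interpret ping_pong \<Gamma> X \<phi> s c n U x
  proof
    fix b i k z
    show "s b \<in> carrier \<Gamma>" using elems by (simp add: s_def)
    show "U b \<subseteq> X" using subsets by (simp add: U_def)
    show "x \<in> X" by (rule point)
    show "x \<notin> U b" using h1 by (simp add: U_def)
    show "c b i \<in> carrier \<Gamma>" "c (\<not> b) i = inv\<^bsub>\<Gamma>\<^esub> c b i" if "i \<in> {1..n}"
      using \<gamma>[OF that] by (simp_all add: c_def int_pow_neg)
    assume k: "(k::int) \<noteq> 0"
    show "\<phi> (s b [^]\<^bsub>\<Gamma>\<^esub> k) x \<in> U b" using h[OF k] by blast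
    show "\<phi> (s b [^]\<^bsub>\<Gamma>\<^esub> k) z \<in> U b" if "z \<in> U (\<not> b)"
      using h[OF k] that by blast
    show "\<phi> (s b [^]\<^bsub>\<Gamma>\<^esub> k) (\<phi> (c b i) z) \<in> U b" if "i \<in> {1..n}" "z \<in> U (\<not> b)"
    proof -
      \<comment> \<open>The sign \<epsilon> is 1 for \<sigma> and -1 for \<tau>, matching the middle
        factor of \<open>Conj b i\<close>.\<close>
      have "\<phi> (c b i) z \<in> (\<Union>\<epsilon>\<in>{1, -1::int}. \<Union>i\<in>{1..n}. \<phi> (\<gamma> i [^]\<^bsub>\<Gamma>\<^esub> \<epsilon>) ` U (\<not> b))"
        unfolding c_def using that by (intro UN_I[of "if b then 1 else - 1"] UN_I[of i] imageI) auto
      then show ?thesis using h[OF k, of b] by blast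
    qed
  qed
  have "c True ` {1..n} = \<gamma> ` {1..n}"
    using \<gamma> by (intro image_cong) (auto simp: c_def)
  then have "generate \<Gamma> (c True ` {1..n}) = carrier \<Gamma>"
    using gen by (simp add: finite_generating_set_def)
  \<comment> \<open>A cyclic group is abelian, so the commutator argument excludes it.\<close>
  then show ?thesis
    using infinite_girth not_comm_group cyclic_imp_abelian_group by blast
qed

end
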